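(* Let $M\ge2$. Observe $\mathbf y=\mathbf f+\boldsymbol\xi$ with $\boldsymbol\xi\sim\mathcal N(0,\sigma^2I_{n\times n})$. For $j=1,\dots,M$ let $\hat{\boldsymbol\mu}_j=A_j\mathbf y+\mathbf b_j$ with deterministic $n\times n$ matrices satisfying $\|A_j\|_{op}\le1$ and deterministic $\mathbf b_j\in\mathbf R^n$. Let $\boldsymbol\pi=(\pi_1,\dots,\pi_M)^T\in\Lambda^M$ (deterministic). Let $\hat{\boldsymbol\theta}_{\boldsymbol\pi}\in\arg\min_{\boldsymbol\theta\in\Lambda^M}V_{\mathrm{pen}}(\boldsymbol\theta)$, where $V_{\mathrm{pen}}(\boldsymbol\theta)=H_{\mathrm{pen}}(\boldsymbol\theta)+46\sigma^2\sum_{j=1}^M\theta_j\log\frac1{\pi_j}$. Then for all $x>0$, with probability at least $1-2e^{-x}$, \[\|\hat{\boldsymbol\mu}_{\hat{\boldsymbol\theta}_{\boldsymbol\pi}}-\mathbf f\|_2^2\le\min_{j=1,\dots,M}\Big(\|\hat{\boldsymbol\mu}_j-\mathbf f\|_2^2+92\sigma^2\log\frac1{\pi_j}\Big)+46\sigma^2x.\]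
   Context: $\Lambda^M=\{\boldsymbol\theta\in\mathbf R^M:\sum_j\theta_j=1,\theta_j\ge0\}$. For $\boldsymbol\theta\in\Lambda^M$: $A_{\boldsymbol\theta}=\sum_j\theta_jA_j$, $\mathbf b_{\boldsymbol\theta}=\sum_j\theta_j\mathbf b_j$, $\hat{\boldsymbol\mu}_{\boldsymbol\theta}=A_{\boldsymbol\theta}\mathbf y+\mathbf b_{\boldsymbol\theta}$. $C_p(\boldsymbol\theta)=\|\hat{\boldsymbol\mu}_{\boldsymbol\theta}\|_2^2-2\mathbf y^T\hat{\boldsymbol\mu}_{\boldsymbol\theta}+2\sigma^2\mathrm{Tr}(A_{\boldsymbol\theta})$, $\mathrm{pen}(\boldsymbol\theta)=\sum_j\theta_j\|\hat{\boldsymbol\mu}_{\boldsymbol\theta}-\hat{\boldsymbol\mu}_j\|_2^2$, $H_{\mathrm{pen}}=C_p+\tfrac12\mathrm{pen}$. Natural logarithm; $\log(1/0)=+\infty$. *)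

theory Defs
  imports "HOL-Analysis.Analysis" "HOL-Library.Extended_Real"
begin

definition simplexM :: "(real^'m::finite) set" where
  "simplexM = {\<theta>. (\<Sum>j\<in>UNIV. \<theta>$j) = 1 \<and> (\<forall>j. \<theta>$j \<ge> 0)}"

definition A_th :: "('m::finite \<Rightarrow> real^'n::finite^'n) \<Rightarrow> real^'m \<Rightarrow> real^'n^'n" where
  "A_th A \<theta> = (\<Sum>j\<in>UNIV. \<theta>$j *\<^sub>R A j)"

definition b_th :: "('m::finite \<Rightarrow> real^'n::finite) \<Rightarrow> real^'m \<Rightarrow> real^'n" where
  "b_th b \<theta> = (\<Sum>j\<in>UNIV. \<theta>$j *\<^sub>R b j)"

definition mu_th :: "('m::finite \<Rightarrow> real^'n::finite^'n) \<Rightarrow> ('m \<Rightarrow> real^'n) \<Rightarrow> real^'m \<Rightarrow> real^'n \<Rightarrow> real^'n" where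
  "mu_th A b \<theta> y = A_th A \<theta> *v y + b_th b \<theta>"

definition mu_j :: "('m::finite \<Rightarrow> real^'n::finite^'n) \<Rightarrow> ('m \<Rightarrow> real^'n) \<Rightarrow> 'm \<Rightarrow> real^'n \<Rightarrow> real^'n" where
  "mu_j A b j y = A j *v y + b j"

definition Cp :: "('m::finite \<Rightarrow> real^'n::finite^'n) \<Rightarrow> ('m \<Rightarrow> real^'n) \<Rightarrow> real \<Rightarrow> real^'n \<Rightarrow> real^'m \<Rightarrow> real" where
  "Cp A b \<sigma> y \<theta> = (norm (mu_th A b \<theta> y))^2 - 2 * (y \<bullet> mu_th A b \<theta> y) + 2 * \<sigma>^2 * trace (A_th A \<theta>)"

definition pen :: "('m::finite \<Rightarrow> real^'n::finite^'n) \<Rightarrow> ('m \<Rightarrow> real^'n) \<Rightarrow> real^'n \<Rightarrow> real^'m \<Rightarrow> real" where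
  "pen A b y \<theta> = (\<Sum>j\<in>UNIV. \<theta>$j * (norm (mu_th A b \<theta> y - mu_j A b j y))^2)"

definition Hpen :: "('m::finite \<Rightarrow> real^'n::finite^'n) \<Rightarrow> ('m \<Rightarrow> real^'n) \<Rightarrow> real \<Rightarrow> real^'n \<Rightarrow> real^'m \<Rightarrow> real" where
  "Hpen A b \<sigma> y \<theta> = Cp A b \<sigma> y \<theta> + pen A b y \<theta> / 2"

definition logInv :: "real \<Rightarrow> ereal" where
  "logInv p = (if p = 0 then \<infinity> else ereal (ln (1 / p)))"

text \<open>V_pen(theta) = H_pen(theta) + 46 sigma^2 sum_j theta_j log(1/pi_j), in extended reals
  (with the ereal convention 0 * infinity = 0).\<close>
definition Vpen :: "('m::finite \<Rightarrow> real^'n::finite^'n) \<Rightarrow> ('m \<Rightarrow> real^'n) \<Rightarrow> real \<Rightarrow> real^'m \<Rightarrow> real^'n \<Rightarrow> real^'m \<Rightarrow> ereal" where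
  "Vpen A b \<sigma> \<pi> y \<theta> = ereal (Hpen A b \<sigma> y \<theta>) + ereal (46 * \<sigma>^2) * (\<Sum>j\<in>UNIV. ereal (\<theta>$j) * logInv (\<pi>$j))"

definition gaussian_vec :: "real \<Rightarrow> (real^'n::finite) measure" where
  "gaussian_vec \<sigma> = density lborel
     (\<lambda>z. ennreal ((2 * pi * \<sigma>^2) powr (- real CARD('n) / 2) * exp (- ((norm z)^2) / (2 * \<sigma>^2))))"

end

theory Submission
  imports Defs "HOL-Probability.Probability"
begin

text \<open>
  The criterion is quadratic along segments, so its minimiser beats each vertex by an additional
  squared distance. Together with the penalty, this bounds the excess loss against estimator k by a
  convex combination of the statistics q(j,k) = 2 xi.p - 2 sigma^2 tr B - |p|^2 / 2, where
  B = A_j - A_k and p = mu_j - mu_k is affine in the noise xi with linear part B. It then suffices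
  that E exp(q(j,k) / (46 sigma^2)) is at most 1, followed by Markov's inequality and a union bound
  with weights pi_j pi_k.

  For the exponential moment, the exponent of the integrand is dominated by that of a Gaussian
  composed with an affine map with linear part T = I - C, C = 2/46 B - 7/920 B^T B. The
  resulting factor 1 / |det T| is bounded by exp ((|M|^2 - n) / 2), with M the inverse of T and the
  Frobenius norm: by Jensen's inequality applied to the Gaussian integral of exp (|z|^2/2 - |Mz|^2/2).
  Expanding M = I + MC gives tr C plus a multiple of |C|^2, and the term -7/920 |B|^2
  in tr C absorbs the latter.
\<close>

section \<open>The Gaussian density: total mass and coordinate second moments\<close>

text \<open>A real-valued form of the density inside \<open>gaussian_vec\<close>, so that pointwise
  estimates stay in the reals and \<open>ennreal\<close> enters only under integrals.\<close>

definition gaussian_dens :: "real \<Rightarrow> real^'n::finite \<Rightarrow> real" where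
  "gaussian_dens \<sigma> z = (2 * pi * \<sigma>\<^sup>2) powr (- real CARD('n) / 2) * exp (- (norm z)\<^sup>2 / (2 * \<sigma>\<^sup>2))"

lemma gaussian_dens_nonneg [simp]: "0 \<le> gaussian_dens \<sigma> z"
  by (simp add: gaussian_dens_def)

lemma gaussian_dens_measurable [measurable]: "gaussian_dens \<sigma> \<in> borel_measurable borel"
  unfolding gaussian_dens_def by measurable

lemma gaussian_vec_eq: "gaussian_vec \<sigma> = density lborel (\<lambda>z. ennreal (gaussian_dens \<sigma> z))"
  by (simp add: gaussian_vec_def gaussian_dens_def)

lemma gaussian_dens_eq_prod:
  fixes z :: "real^'n::finite"
  assumes "\<sigma> > 0"
  shows "gaussian_dens \<sigma> z = (\<Prod>b\<in>Basis. normal_density 0 \<sigma> (z \<bullet> b))"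
proof -
  have "(\<Prod>b\<in>Basis. normal_density 0 \<sigma> (z \<bullet> b)) =
      (\<Prod>b\<in>(Basis::(real^'n) set). 1 / sqrt (2 * pi * \<sigma>\<^sup>2)) * (\<Prod>b\<in>Basis. exp (- (z \<bullet> b)\<^sup>2 / (2 * \<sigma>\<^sup>2)))"
    unfolding normal_density_def by (simp only: prod.distrib diff_zero)
  also have "(\<Prod>b\<in>(Basis::(real^'n) set). 1 / sqrt (2 * pi * \<sigma>\<^sup>2)) = (1 / sqrt (2 * pi * \<sigma>\<^sup>2)) ^ CARD('n)"
    by simp
  also have "\<dots> = (2 * pi * \<sigma>\<^sup>2) powr (- real CARD('n) / 2)"
  proof -
    have pos: "0 < 2 * pi * \<sigma>\<^sup>2" using assms by simp
    then have "1 / sqrt (2 * pi * \<sigma>\<^sup>2) = (2 * pi * \<sigma>\<^sup>2) powr (- 1 / 2)"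
      using powr_minus_divide[of "2 * pi * \<sigma>\<^sup>2" "1 / 2"]
      by (simp only: powr_half_sqrt[symmetric] less_imp_le minus_divide_left)
    then have "(1 / sqrt (2 * pi * \<sigma>\<^sup>2)) ^ CARD('n) = ((2 * pi * \<sigma>\<^sup>2) powr (- 1 / 2)) powr real CARD('n)"
      using pos by (simp only: powr_realpow powr_gt_zero)
    then show ?thesis by (simp only: powr_powr) simp
  qed
  also have "(\<Prod>b\<in>Basis. exp (- (z \<bullet> b)\<^sup>2 / (2 * \<sigma>\<^sup>2))) = exp (- (norm z)\<^sup>2 / (2 * \<sigma>\<^sup>2))"
    unfolding power2_norm_eq_inner euclidean_inner[of z z]
    by (simp add: exp_sum[symmetric] sum_negf sum_divide_distrib power2_eq_square)
  finally show ?thesis by (simp add: gaussian_dens_def)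
qed

lemma nn_integral_gaussian_dens:
  assumes "\<sigma> > 0"
  shows "(\<integral>\<^sup>+z. gaussian_dens \<sigma> (z::real^'n::finite) \<partial>lborel) = 1"
proof -
  have "(\<integral>\<^sup>+z. gaussian_dens \<sigma> (z::real^'n) \<partial>lborel)
      = (\<integral>\<^sup>+z. (\<Prod>b\<in>(Basis::(real^'n) set). ennreal (normal_density 0 \<sigma> (z \<bullet> b))) \<partial>lborel)"
    by (simp add: gaussian_dens_eq_prod[OF assms] prod_ennreal)
  also have "\<dots> = (\<Prod>b\<in>(Basis::(real^'n) set). (\<integral>\<^sup>+x. ennreal (normal_density 0 \<sigma> x) \<partial>lborel))"
    by (rule nn_integral_lborel_prod) auto
  also have "(\<integral>\<^sup>+x. ennreal (normal_density 0 \<sigma> x) \<partial>lborel) = 1"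
    using assms by (simp add: nn_integral_eq_integral)
  finally show ?thesis by simp
qed

text \<open>The integrand is still a product over the basis: the square is absorbed into the factor
  of \<open>axis i 1\<close>, which then integrates to the variance 1, and every other factor has
  integral 1.\<close>

lemma nn_integral_gaussian_dens_coord_sq:
  fixes i :: "'n::finite"
  shows "(\<integral>\<^sup>+z. gaussian_dens 1 (z::real^'n) * (z $ i)\<^sup>2 \<partial>lborel) = 1"
proof -
  define g :: "real^'n \<Rightarrow> real \<Rightarrow> real"
    where "g b x = normal_density 0 1 x * (if b = axis i 1 then x\<^sup>2 else 1)" for b x
  have i: "axis i 1 \<in> (Basis::(real^'n) set)" by (simp add: axis_in_Basis_iff)
  have "gaussian_dens 1 z * (z $ i)\<^sup>2 = (\<Prod>b\<in>Basis. g b (z \<bullet> b))" for z :: "real^'n"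
  proof -
    have "(\<Prod>b\<in>(Basis::(real^'n) set). if b = axis i 1 then (z \<bullet> b)\<^sup>2 else 1) = (z $ i)\<^sup>2"
      using i by (simp add: cart_eq_inner_axis)
    then show ?thesis
      unfolding g_def prod.distrib by (simp add: gaussian_dens_eq_prod)
  qed
  then have "(\<integral>\<^sup>+z. gaussian_dens 1 (z::real^'n) * (z $ i)\<^sup>2 \<partial>lborel)
      = (\<integral>\<^sup>+z. (\<Prod>b\<in>(Basis::(real^'n) set). ennreal (g b (z \<bullet> b))) \<partial>lborel)"
    by (simp add: prod_ennreal g_def)
  also have "\<dots> = (\<Prod>b\<in>(Basis::(real^'n) set). (\<integral>\<^sup>+x. ennreal (g b x) \<partial>lborel))"
    by (rule nn_integral_lborel_prod) (auto simp: g_def)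
  also have "\<dots> = (\<Prod>b\<in>(Basis::(real^'n) set). 1)"
  proof (rule prod.cong)
    fix b :: "real^'n"
    have "(\<integral>\<^sup>+x. ennreal (normal_density 0 1 x * x\<^sup>2) \<partial>lborel) = 1"
      using integral_std_normal_moment_even[of 1] integrable_normal_moment[of 1 0 2]
      by (simp add: nn_integral_eq_integral)
    moreover have "(\<integral>\<^sup>+x. ennreal (normal_density 0 1 x) \<partial>lborel) = 1"
      by (simp add: nn_integral_eq_integral)
    ultimately show "(\<integral>\<^sup>+x. ennreal (g b x) \<partial>lborel) = 1"
      by (cases "b = axis i 1") (auto simp: g_def)
  qed simp
  finally show ?thesis by simp
qed

section \<open>Lebesgue measure under translation, reflection and linear bijections\<close>

lemma nn_integral_lborel_translate:
  fixes F :: "'a::euclidean_space \<Rightarrow> ennreal"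
  assumes [measurable]: "F \<in> borel_measurable borel"
  shows "(\<integral>\<^sup>+z. F (t + z) \<partial>lborel) = (\<integral>\<^sup>+z. F z \<partial>lborel)"
  by (subst (2) lborel_distr_plus[of t, symmetric]) (simp add: nn_integral_distr)

lemma nn_integral_lborel_reflect:
  fixes F :: "'a::euclidean_space \<Rightarrow> ennreal"
  assumes [measurable]: "F \<in> borel_measurable borel"
  shows "(\<integral>\<^sup>+z. F (- z) \<partial>lborel) = (\<integral>\<^sup>+z. F z \<partial>lborel)"
proof -
  have "distr lborel borel uminus = (lborel :: 'a measure)"
    using lborel_affine_euclidean[where c="\<lambda>_. - 1" and t=0 and 'a='a]
    by (simp add: sum_negf euclidean_representation density_1)
  then show ?thesis
    using nn_integral_distr[of uminus lborel borel F] by simp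
qed

text \<open>Uniqueness of Haar measure, with the Gaussian as normalising function. The determinant formula
  of HOL-Analysis is restricted to well-ordered index types.\<close>
lemma nn_integral_lborel_linear:
  fixes T :: "real^'n::finite \<Rightarrow> real^'n" and F :: "real^'n \<Rightarrow> ennreal"
  assumes T: "linear T" "surj T" and [measurable]: "F \<in> borel_measurable borel"
  shows "(\<integral>\<^sup>+z. F (T z) \<partial>lborel) = (\<integral>\<^sup>+z. gaussian_dens 1 (T z) \<partial>lborel) * (\<integral>\<^sup>+z. F z \<partial>lborel)"
proof -
  define G where "G z = ennreal (gaussian_dens 1 (z::real^'n))" for z
  have [measurable]: "G \<in> borel_measurable borel" by (simp add: G_def[abs_def])
  have [measurable]: "T \<in> borel_measurable borel"
    by (intro borel_measurable_continuous_onI linear_continuous_on T(1)[THEN linear_conv_bounded_linear[THEN iffD1]])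
  have "(\<integral>\<^sup>+z. G (T z) \<partial>lborel) * (\<integral>\<^sup>+z. F z \<partial>lborel)
      = (\<integral>\<^sup>+z. (\<integral>\<^sup>+x. G (T z) * F x \<partial>lborel) \<partial>lborel)"
    by (simp add: nn_integral_cmult nn_integral_multc)
  also have "\<dots> = (\<integral>\<^sup>+z. (\<integral>\<^sup>+x. G (T z) * F (T z + x) \<partial>lborel) \<partial>lborel)"
    by (simp add: nn_integral_cmult nn_integral_lborel_translate)
  also have "\<dots> = (\<integral>\<^sup>+x. (\<integral>\<^sup>+z. G (T z) * F (T z + x) \<partial>lborel) \<partial>lborel)"
    by (rule lborel_pair.Fubini') measurable
  also have "\<dots> = (\<integral>\<^sup>+x. (\<integral>\<^sup>+z. G (T z - x) * F (T z) \<partial>lborel) \<partial>lborel)"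
  proof (rule nn_integral_cong)
    fix x
    \<comment> \<open>Surjectivity of \<open>T\<close> turns the shift by \<open>x\<close> into a
      translation of \<open>z\<close> by \<open>u\<close>, which moves the shift from
      \<open>F\<close> to \<open>G\<close>.\<close>
    obtain u where u: "x = T u" using T(2) by blast
    have "(\<integral>\<^sup>+z. G (T (- u + (u + z))) * F (T (u + z)) \<partial>lborel) = (\<integral>\<^sup>+z. G (T (- u + z)) * F (T z) \<partial>lborel)"
      by (rule nn_integral_lborel_translate[of "\<lambda>z. G (T (- u + z)) * F (T z)" u]) measurable
    then show "(\<integral>\<^sup>+z. G (T z) * F (T z + x) \<partial>lborel) = (\<integral>\<^sup>+z. G (T z - x) * F (T z) \<partial>lborel)"
      by (simp add: u linear_add[OF T(1)] linear_diff[OF T(1)] add.commute)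
  qed
  also have "\<dots> = (\<integral>\<^sup>+z. (\<integral>\<^sup>+x. G (T z - x) * F (T z) \<partial>lborel) \<partial>lborel)"
    by (rule lborel_pair.Fubini') measurable
  also have "\<dots> = (\<integral>\<^sup>+z. F (T z) \<partial>lborel)"
  proof (rule nn_integral_cong)
    fix z
    \<comment> \<open>After the exchange of integrals, \<open>x\<close> occurs only in a reflected
      and translated copy of \<open>G\<close>, whose mass is 1.\<close>
    have "(\<integral>\<^sup>+x. G (T z - x) \<partial>lborel) = (\<integral>\<^sup>+x. G (T z + x) \<partial>lborel)"
      using nn_integral_lborel_reflect[of "\<lambda>x. G (T z + x)"] by simp
    also have "\<dots> = 1"
      by (simp add: nn_integral_lborel_translate) (simp add: G_def nn_integral_gaussian_dens)
    finally show "(\<integral>\<^sup>+x. G (T z - x) * F (T z) \<partial>lborel) = F (T z)"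
      by (simp add: nn_integral_multc)
  qed
  finally show ?thesis by (simp add: G_def)
qed

section \<open>Second moments of linear images and a Jensen lower bound\<close>

text \<open>An orthogonal map takes \<open>r\<close> to a multiple of a coordinate axis and
  preserves the density, so the constant in \<open>nn_integral_lborel_linear\<close> is 1 and the
  second moment of one coordinate suffices.\<close>

lemma nn_integral_gaussian_dens_inner_sq:
  fixes r :: "real^'n::finite"
  shows "(\<integral>\<^sup>+z. gaussian_dens 1 z * (r \<bullet> z)\<^sup>2 \<partial>lborel) = ennreal ((norm r)\<^sup>2)"
proof -
  fix i :: 'n
  obtain T :: "real^'n \<Rightarrow> real^'n" where T: "orthogonal_transformation T" "T r = norm r *\<^sub>R axis i 1"
    using orthogonal_transformation_exists[of r "norm r *\<^sub>R axis i 1"] by auto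
  have lin: "linear T" and sur: "surj T"
    using T orthogonal_transformation_linear orthogonal_transformation_surj by blast+
  have dens: "gaussian_dens 1 (T z) = gaussian_dens 1 z" for z
    by (simp add: gaussian_dens_def orthogonal_transformation_norm[OF T(1)])
  have inn: "r \<bullet> z = norm r * (T z $ i)" for z
  proof -
    have "r \<bullet> z = T r \<bullet> T z" using T(1) by (simp add: orthogonal_transformation_def)
    then show ?thesis by (simp add: T(2) inner_axis')
  qed
  have "(\<integral>\<^sup>+z. gaussian_dens 1 z * (r \<bullet> z)\<^sup>2 \<partial>lborel)
      = (\<integral>\<^sup>+z. ennreal ((norm r)\<^sup>2) * ennreal (gaussian_dens 1 (T z) * (T z $ i)\<^sup>2) \<partial>lborel)"
    by (intro nn_integral_cong) (simp add: dens inn power_mult_distrib mult_ac flip: ennreal_mult')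
  also have "\<dots> = ennreal ((norm r)\<^sup>2) * (\<integral>\<^sup>+z. ennreal (gaussian_dens 1 z * (z $ i)\<^sup>2) \<partial>lborel)"
  proof -
    have [measurable]: "T \<in> borel_measurable borel"
      by (intro borel_measurable_continuous_onI linear_continuous_on lin[THEN linear_conv_bounded_linear[THEN iffD1]])
    show ?thesis
      using nn_integral_lborel_linear[OF lin sur, of "\<lambda>z. ennreal (gaussian_dens 1 z * (z $ i)\<^sup>2)"]
      unfolding cart_eq_inner_axis by (subst nn_integral_cmult) (simp_all add: dens nn_integral_gaussian_dens)
  qed
  finally show ?thesis by (simp add: nn_integral_gaussian_dens_coord_sq)
qed

text \<open>Meant for a minorant \<open>h\<close> that may take negative values: its positive part
  has a larger integral and still lies below \<open>g\<close> after truncation at 0 in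
  \<open>ennreal\<close>.\<close>

lemma integral_le_nn_integral:
  fixes h g :: "'a \<Rightarrow> real"
  assumes "integrable M h" "\<And>z. h z \<le> g z"
  shows "ennreal (integral\<^sup>L M h) \<le> (\<integral>\<^sup>+z. g z \<partial>M)"
proof -
  have "integral\<^sup>L M h \<le> (\<integral>z. max 0 (h z) \<partial>M)"
    using assms(1) by (intro integral_mono) auto
  then have "ennreal (integral\<^sup>L M h) \<le> ennreal (\<integral>z. max 0 (h z) \<partial>M)"
    by (rule ennreal_leI)
  also have "\<dots> = (\<integral>\<^sup>+z. max 0 (h z) \<partial>M)"
    using assms(1) by (subst nn_integral_eq_integral) auto
  also have "\<dots> \<le> (\<integral>\<^sup>+z. g z \<partial>M)"
    using assms(2) by (intro nn_integral_mono) (auto simp: ennreal_max_0 intro: ennreal_leI)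
  finally show ?thesis .
qed

lemma power2_norm_vec: "(norm (z::'a::real_normed_vector^'n::finite))\<^sup>2 = (\<Sum>i\<in>UNIV. (norm (z $ i))\<^sup>2)"
  by (simp add: norm_vec_def L2_set_def sum_nonneg)

lemma integrable_gaussian_dens: "integrable lborel (gaussian_dens 1 :: real^'n::finite \<Rightarrow> real)"
  and integral_gaussian_dens: "integral\<^sup>L lborel (gaussian_dens 1 :: real^'n::finite \<Rightarrow> real) = 1"
  using has_bochner_integral_nn_integral[of "gaussian_dens 1 :: real^'n \<Rightarrow> real" lborel 1] nn_integral_gaussian_dens[of 1, where 'n='n]
  by (auto simp: has_bochner_integral_iff)

lemma integrable_gaussian_dens_inner_sq: "integrable lborel (\<lambda>z. gaussian_dens 1 z * (r \<bullet> (z::real^'n::finite))\<^sup>2)"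
  and integral_gaussian_dens_inner_sq: "(\<integral>z. gaussian_dens 1 z * (r \<bullet> (z::real^'n::finite))\<^sup>2 \<partial>lborel) = (norm r)\<^sup>2"
  using has_bochner_integral_nn_integral[of "\<lambda>z. gaussian_dens 1 z * (r \<bullet> (z::real^'n::finite))\<^sup>2" lborel "(norm r)\<^sup>2"]
    nn_integral_gaussian_dens_inner_sq[of r]
  by (auto simp: has_bochner_integral_iff)

lemma power2_norm_matrix_vector: "(norm (M *v (z::real^'n::finite)))\<^sup>2 = (\<Sum>i\<in>UNIV. (M $ i \<bullet> z)\<^sup>2)"
  by (simp add: power2_norm_vec matrix_vector_mul_component)

text \<open>The coordinates of \<open>M *v z\<close> are inner products with the rows of
  \<open>M\<close>, and \<open>norm M\<close> is the Frobenius norm, whose square sums the squared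
  row norms.\<close>

lemma
  fixes M :: "real^'n::finite^'n"
  shows integrable_gaussian_dens_matrix: "integrable lborel (\<lambda>z. gaussian_dens 1 z * (norm (M *v z))\<^sup>2)"
    and integral_gaussian_dens_matrix: "(\<integral>z. gaussian_dens 1 z * (norm (M *v z))\<^sup>2 \<partial>lborel) = (norm M)\<^sup>2"
  unfolding power2_norm_matrix_vector power2_norm_vec[of M] sum_distrib_left
  by (simp_all add: integrable_gaussian_dens_inner_sq integral_gaussian_dens_inner_sq)

lemma power2_norm_mat_1: "(norm (mat 1 :: real^'n::finite^'n))\<^sup>2 = real CARD('n)"
proof -
  have "(norm (mat 1 $ i :: real^'n))\<^sup>2 = 1" for i
  proof -
    have "(mat 1 $ i :: real^'n) = axis i 1" by (simp add: mat_def axis_def vec_eq_iff)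
    then show ?thesis by simp
  qed
  then show ?thesis by (simp add: power2_norm_vec[of "mat 1"])
qed

text \<open>Jensen's inequality: the tangent line of exp at the mean of the exponent.\<close>
lemma nn_integral_gaussian_dens_linear_ge:
  fixes M :: "real^'n::finite^'n"
  shows "ennreal (exp ((real CARD('n) - (norm M)\<^sup>2) / 2)) \<le> (\<integral>\<^sup>+z. gaussian_dens 1 (M *v z) \<partial>lborel)"
proof -
  \<comment> \<open>\<open>m\<close> is the mean of |z|^2/2 - |Mz|^2/2 under the standard Gaussian.
    In \<open>h\<close>, |z| is written as the norm of \<open>mat 1 *v z\<close>, so that one moment
    formula covers both squares.\<close>
  define m where "m = (real CARD('n) - (norm M)\<^sup>2) / 2"
  define h where "h z = exp m * ((1 - m) * gaussian_dens 1 z + gaussian_dens 1 z * (norm (mat 1 *v z))\<^sup>2 / 2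
     - gaussian_dens 1 z * (norm (M *v z))\<^sup>2 / 2)" for z :: "real^'n"
  note [simp] = integrable_gaussian_dens_matrix integral_gaussian_dens_matrix
    integrable_gaussian_dens integral_gaussian_dens
  have int: "integrable lborel h"
    unfolding h_def by (intro integrable_mult_right Bochner_Integration.integrable_add
        Bochner_Integration.integrable_diff integrable_divide integrable_gaussian_dens_matrix integrable_gaussian_dens)
  have "integral\<^sup>L lborel h = exp m * (1 - m + (norm (mat 1 :: real^'n^'n))\<^sup>2 / 2 - (norm M)\<^sup>2 / 2)"
    unfolding h_def
    by (simp add: integral_gaussian_dens_matrix[of "mat 1", simplified] integrable_gaussian_dens_matrix[of "mat 1", simplified])
  also have "\<dots> = exp m"
    by (simp add: power2_norm_mat_1 m_def field_simps)
  finally have eq: "integral\<^sup>L lborel h = exp m" .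
  have "h z \<le> gaussian_dens 1 (M *v z)" for z
  proof -
    define X where "X = (norm z)\<^sup>2 / 2 - (norm (M *v z))\<^sup>2 / 2"
    have "exp m * (1 + (X - m)) \<le> exp m * exp (X - m)"
      by (intro mult_left_mono exp_ge_add_one_self) simp
    then have "exp m * (1 + (X - m)) \<le> exp X"
      by (simp flip: exp_add)
    then have "gaussian_dens 1 z * (exp m * (1 + (X - m))) \<le> gaussian_dens 1 z * exp X"
      by (intro mult_left_mono) simp_all
    also have "gaussian_dens 1 z * exp X = gaussian_dens 1 (M *v z)"
      by (simp add: gaussian_dens_def X_def field_simps flip: exp_add)
    also have "gaussian_dens 1 z * (exp m * (1 + (X - m))) = h z"
      by (simp add: h_def X_def algebra_simps add_divide_distrib diff_divide_distrib)
    finally show ?thesis .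
  qed
  from integral_le_nn_integral[OF int this] show ?thesis
    unfolding eq m_def .
qed

section \<open>Trace and Frobenius norm\<close>

lemma matrix_add_rdistrib: "(B + C) ** A = B ** A + C ** (A :: 'a::semiring_1^'n^'m::finite)"
  by (vector matrix_matrix_mult_def sum.distrib[symmetric] field_simps)

lemma trace_eq_inner_mat_1: "trace (X::real^'n::finite^'n) = mat 1 \<bullet> X"
  by (simp add: trace_def inner_vec_def mat_def if_distrib if_distribR cong: if_cong)

text \<open>Exhibits the trace of a product as a Frobenius inner product, which opens it to
  Cauchy-Schwarz.\<close>

lemma trace_matrix_mult: "trace (X ** Y) = transpose X \<bullet> (Y :: real^'n::finite^'n)"
proof -
  have "trace (X ** Y) = (\<Sum>i\<in>UNIV. \<Sum>k\<in>UNIV. X$i$k * Y$k$i)"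
    by (simp add: trace_def matrix_matrix_mult_def)
  also have "\<dots> = (\<Sum>k\<in>UNIV. \<Sum>i\<in>UNIV. X$i$k * Y$k$i)"
    by (rule sum.swap)
  also have "\<dots> = transpose X \<bullet> Y"
    by (simp add: inner_vec_def transpose_def)
  finally show ?thesis .
qed

lemma norm_transpose: "norm (transpose X) = norm (X :: real^'n::finite^'n)"
proof -
  have "transpose X \<bullet> transpose X = X \<bullet> X"
    unfolding inner_vec_def by (simp add: transpose_def) (rule sum.swap)
  then show ?thesis by (simp add: norm_eq_sqrt_inner)
qed

text \<open>The columns of \<open>X ** Y\<close> are the images under \<open>X\<close> of the
  columns of \<open>Y\<close>, and the squared Frobenius norm is the sum of the squared column
  norms.\<close>

lemma norm_matrix_mult_le:
  fixes X Y :: "real^'n::finite^'n"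
  assumes "\<And>v. norm (X *v v) \<le> c * norm v" "0 \<le> c"
  shows "norm (X ** Y) \<le> c * norm Y"
proof -
  have col: "(transpose (X ** Y)) $ j = X *v (transpose Y $ j)" for j
    by (simp add: transpose_def matrix_matrix_mult_def matrix_vector_mult_def vec_eq_iff)
  have "(norm (X ** Y))\<^sup>2 = (\<Sum>j\<in>UNIV. (norm (X *v (transpose Y $ j)))\<^sup>2)"
    by (simp add: norm_transpose[of "X ** Y", symmetric] power2_norm_vec[of "transpose (X ** Y)"] col)
  also have "\<dots> \<le> (\<Sum>j\<in>UNIV. (c * norm (transpose Y $ j))\<^sup>2)"
    by (intro sum_mono power_mono assms) simp
  also have "\<dots> = (c * norm Y)\<^sup>2"
    by (simp add: power_mult_distrib norm_transpose[of Y, symmetric] power2_norm_vec[of "transpose Y"] sum_distrib_left)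
  finally show ?thesis
    using assms(2) by (simp add: power2_le_iff_abs_le)
qed

section \<open>Gaussian integrals under affine maps close to the identity\<close>

lemma nn_integral_gaussian_dens_affine_le:
  fixes C :: "real^'n::finite^'n"
  assumes "\<sigma> > 0" and C: "\<And>v. norm (C *v v) \<le> norm v / 8"
  shows "(\<integral>\<^sup>+z. gaussian_dens \<sigma> ((mat 1 - C) *v z + \<tau>) \<partial>lborel) \<le> exp (trace C + 9/5 * (norm C)\<^sup>2)"
proof -
  define T where "T = mat 1 - C"
  have T: "T *v v = v - C *v v" for v by (simp add: T_def matrix_vector_mult_diff_rdistrib)
  \<comment> \<open>\<open>T\<close> keeps at least 1 - 1/8 of every length; hence it is invertible
    and its inverse has operator norm at most 8/7.\<close>
  have T_ge: "7/8 * norm v \<le> norm (T *v v)" for v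
    using norm_triangle_ineq2[of v "C *v v"] C[of v] by (simp add: T)
  have "inj ((*v) T)"
  proof (rule injI)
    fix u v assume "T *v u = T *v v"
    then have "T *v (u - v) = 0" by (simp add: matrix_vector_mult_diff_distrib)
    with T_ge[of "u - v"] show "u = v" by simp
  qed
  then have surj: "surj ((*v) T)"
    using linear_injective_imp_surjective[of "(*v) T"] by simp
  from \<open>inj ((*v) T)\<close> obtain M where MT: "M ** T = mat 1"
    using matrix_left_invertible_injective[of T] by auto
  then have TM: "T ** M = mat 1" by (simp add: matrix_left_right_inverse)
  have M1: "M = mat 1 + M ** C"
    using MT matrix_add_ldistrib[of M T C] by (simp add: T_def)
  have M2: "M = mat 1 + C ** M"
    using TM matrix_add_rdistrib[of T C M] by (simp add: T_def)
  have M_le: "norm (M *v v) \<le> 8/7 * norm v" for v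
    using T_ge[of "M *v v"] by (simp add: matrix_vector_mul_assoc TM)
  define R where "R = M ** C"
  have R_le: "norm R \<le> 8/7 * norm C"
    unfolding R_def by (rule norm_matrix_mult_le[OF M_le]) simp
  \<comment> \<open>Substituting M = I + CM into R = MC isolates the first-order term
    \<open>C\<close>; the remainder enters the trace only through a Frobenius inner product.\<close>
  have "R = C + C ** R"
    using arg_cong[OF M2, of "\<lambda>X. X ** C"] unfolding R_def matrix_add_rdistrib matrix_mul_assoc matrix_mul_lid .
  then have "trace R = trace C + transpose C \<bullet> R"
    by (metis trace_add trace_matrix_mult)
  also have "transpose C \<bullet> R \<le> norm C * (8/7 * norm C)"
    using norm_cauchy_schwarz[of "transpose C" R] mult_left_mono[OF R_le norm_ge_zero[of C]]
    by (simp add: norm_transpose)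
  finally have trR: "trace R \<le> trace C + 8/7 * (norm C)\<^sup>2"
    by (simp add: power2_eq_square)
  have "(norm R)\<^sup>2 \<le> (8/7 * norm C)\<^sup>2"
    by (intro power_mono R_le) simp
  then have "(norm R)\<^sup>2 \<le> 64/49 * (norm C)\<^sup>2"
    by (simp add: power_mult_distrib power_divide)
  have "(norm M)\<^sup>2 = real CARD('n) + 2 * trace R + (norm R)\<^sup>2"
  proof -
    have "(norm M)\<^sup>2 = (norm (mat 1 + R))\<^sup>2" using M1 by (simp add: R_def)
    then show ?thesis
      using power2_norm_mat_1[where 'n='n]
      by (simp add: power2_norm_eq_inner inner_add_left inner_add_right trace_eq_inner_mat_1 inner_commute)
  qed
  \<comment> \<open>The coefficient of |C|^2 is 8/7 from the trace plus half of 64/49, that is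
    88/49, just below 9/5.\<close>
  then have exponent: "((norm M)\<^sup>2 - real CARD('n)) / 2 \<le> trace C + 9/5 * (norm C)\<^sup>2"
    using trR \<open>(norm R)\<^sup>2 \<le> 64/49 * (norm C)\<^sup>2\<close> zero_le_power2[of "norm C"] by argo
  define K where "K = (\<integral>\<^sup>+z. gaussian_dens 1 (T *v z) \<partial>lborel)"
  have lin: "linear ((*v) T)" by simp
  have K_eq: "(\<integral>\<^sup>+z. F (T *v z) \<partial>lborel) = K * (\<integral>\<^sup>+z. F z \<partial>lborel)"
    if "F \<in> borel_measurable borel" for F
    unfolding K_def using nn_integral_lborel_linear[OF lin surj that] .
  have [measurable]: "(*v) X \<in> borel_measurable borel" for X :: "real^'n^'n"
    by (intro borel_measurable_continuous_onI linear_continuous_on) simp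
  \<comment> \<open>With the density composed with \<open>M\<close> as \<open>F\<close>, the left
    side is the Gaussian mass 1. So \<open>K\<close> is the reciprocal of the integral that Jensen's
    inequality bounds from below.\<close>
  have "(\<integral>\<^sup>+z. gaussian_dens 1 (M *v (T *v z)) \<partial>lborel) = K * (\<integral>\<^sup>+z. gaussian_dens 1 (M *v z) \<partial>lborel)"
    by (rule K_eq) measurable
  then have "K * (\<integral>\<^sup>+z. gaussian_dens 1 (M *v z) \<partial>lborel) = 1"
    by (simp add: matrix_vector_mul_assoc MT nn_integral_gaussian_dens)
  then have "K * exp ((real CARD('n) - (norm M)\<^sup>2) / 2) \<le> 1"
    using mult_left_mono[OF nn_integral_gaussian_dens_linear_ge[of M], of K] by simp
  then have "K * exp ((real CARD('n) - (norm M)\<^sup>2) / 2) * exp (((norm M)\<^sup>2 - real CARD('n)) / 2)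
      \<le> 1 * ennreal (exp (((norm M)\<^sup>2 - real CARD('n)) / 2))"
    by (rule mult_right_mono) simp
  then have K_le: "K \<le> exp (((norm M)\<^sup>2 - real CARD('n)) / 2)"
    by (simp add: mult.assoc flip: ennreal_mult' exp_add add_divide_distrib)
  have "(\<integral>\<^sup>+z. gaussian_dens \<sigma> (T *v z + \<tau>) \<partial>lborel) = K * (\<integral>\<^sup>+z. gaussian_dens \<sigma> (z + \<tau>) \<partial>lborel)"
    by (rule K_eq) measurable
  also have "(\<integral>\<^sup>+z. gaussian_dens \<sigma> (z + \<tau>) \<partial>lborel) = 1"
    using nn_integral_lborel_translate[of "\<lambda>z. ennreal (gaussian_dens \<sigma> z)" \<tau>] nn_integral_gaussian_dens[OF assms(1), where 'n='n]
    by (simp add: add.commute)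
  finally show ?thesis
    using K_le exponent by (auto simp: T_def intro: order_trans ennreal_leI)
qed

section \<open>Exponential moment of the quadratic statistic\<close>

declare transpose_matrix_vector [simp del]

lemma transpose_vector_inner:
  fixes B :: "real^'n::finite^'n"
  shows "u \<bullet> (transpose B *v v) = (B *v u) \<bullet> v"
  by (metis dot_lmul_matrix inner_commute transpose_matrix_vector transpose_transpose)

text \<open>Moving \<open>B\<close> across the inner product bounds the square of the left side by c
  |v| times the left side, which is then cancelled if nonzero.\<close>

lemma norm_transpose_vector_le:
  fixes B :: "real^'n::finite^'n"
  assumes "\<And>v. norm (B *v v) \<le> c * norm v"
  shows "norm (transpose B *v v) \<le> c * norm v"
proof (cases "transpose B *v v = 0")
  case True
  then show ?thesis using order_trans[OF norm_ge_zero assms[of v]] by simp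
next
  case False
  have "(norm (transpose B *v v))\<^sup>2 = v \<bullet> (B *v (transpose B *v v))"
    by (simp add: power2_norm_eq_inner transpose_vector_inner inner_commute)
  also have "\<dots> \<le> norm v * (c * norm (transpose B *v v))"
    using norm_cauchy_schwarz[of v] mult_left_mono[OF assms norm_ge_zero[of v]] order_trans by blast
  finally show ?thesis
    using False by (simp add: power2_eq_square mult.commute mult.left_commute)
qed

text \<open>With r = 0 the difference of the two sides is a multiple of |p|^2. The correction r spends part of
  this slack on the term 7/920 B^T B in the linear part of the affine map; the coefficient 2 of w in
  p + w = Bz + 2w makes z.r equal to a multiple of |p|^2 - |w|^2.\<close>
lemma completed_square_le:
  fixes B :: "real^'n::finite^'n" and z w :: "real^'n"
  assumes B: "\<And>v. norm (B *v v) \<le> 2 * norm v"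
  defines "p \<equiv> B *v z + w"
  defines "r \<equiv> (7/920) *\<^sub>R (transpose B *v (p + w))"
  shows "(norm (z - (2/46) *\<^sub>R p + r))\<^sup>2 \<le> (norm z)\<^sup>2 - 4/46 * (z \<bullet> p) + 1/46 * (norm p)\<^sup>2"
proof -
  define P W where "P = norm p" and "W = norm w"
  have zr: "z \<bullet> r = 7/920 * (P\<^sup>2 - W\<^sup>2)"
  proof -
    have "z \<bullet> r = 7/920 * ((p - w) \<bullet> (p + w))"
      by (simp add: r_def transpose_vector_inner) (simp add: p_def)
    then show ?thesis
      by (simp add: P_def W_def power2_norm_eq_inner inner_diff_left inner_add_right inner_commute algebra_simps)
  qed
  have sum: "norm (p + w) \<le> P + W" unfolding P_def W_def by (rule norm_triangle_ineq)
  have "norm (transpose B *v (p + w)) \<le> 2 * (P + W)"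
    using norm_transpose_vector_le[OF B, of "p + w"] sum by simp
  then have r: "norm r \<le> 7/460 * (P + W)" by (simp add: r_def)
  then have rr: "(norm r)\<^sup>2 \<le> (7/460 * (P + W))\<^sup>2" by (intro power_mono) simp_all
  have pr: "- (p \<bullet> r) \<le> P * (7/460 * (P + W))"
    using norm_cauchy_schwarz[of p "- r"] mult_left_mono[OF r, of P] by (simp add: P_def)
  have PW: "2 * (P * W) \<le> P\<^sup>2 + W\<^sup>2"
    using zero_le_power2[of "P - W"] by (simp add: power2_eq_square algebra_simps)
  have "(norm (z - (2/46) *\<^sub>R p + r))\<^sup>2
      = (norm z)\<^sup>2 - 4/46 * (z \<bullet> p) + 1/529 * P\<^sup>2 + 2 * (z \<bullet> r) - 4/46 * (p \<bullet> r) + (norm r)\<^sup>2"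
    by (simp add: P_def power2_norm_eq_inner inner_diff_left inner_diff_right inner_add_left inner_add_right
        inner_commute algebra_simps)
  \<comment> \<open>Once PW is replaced by half of P^2 + W^2, the coefficient of W^2 is negative
    because of the -7/460 in 2 z.r, and that of P^2 is about 0.0196, below 1/46.\<close>
  also have "\<dots> \<le> (norm z)\<^sup>2 - 4/46 * (z \<bullet> p) + 1/46 * P\<^sup>2"
    using zr rr pr PW zero_le_power2[of P] zero_le_power2[of W]
    unfolding power2_eq_square by argo
  finally show ?thesis by (simp add: P_def)
qed

text \<open>The trace term is the mean of the first term for noise \<open>z\<close> with covariance
  \<sigma>^2 I, so the statistic has mean equal to minus half the mean of |Bz + w|^2.\<close>

definition quad_stat :: "real \<Rightarrow> real^'n::finite^'n \<Rightarrow> real^'n \<Rightarrow> real^'n \<Rightarrow> real" where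
  "quad_stat \<sigma> B w z = 2 * (z \<bullet> (B *v z + w)) - 2 * \<sigma>\<^sup>2 * trace B - (norm (B *v z + w))\<^sup>2 / 2"

lemma nn_integral_exp_quad_stat_le:
  fixes B :: "real^'n::finite^'n"
  assumes \<sigma>: "\<sigma> > 0" and B: "\<And>v. norm (B *v v) \<le> 2 * norm v"
  shows "(\<integral>\<^sup>+z. gaussian_dens \<sigma> z * exp (quad_stat \<sigma> B w z / (46 * \<sigma>\<^sup>2)) \<partial>lborel) \<le> 1"
proof -
  \<comment> \<open>\<open>C\<close> and \<open>\<tau>\<close> are read off from z - (2/46) p + r of
    \<open>completed_square_le\<close>, with p = Bz + w and p + w = Bz + 2w: linear part I - C,
    constant part \<open>\<tau>\<close>.\<close>
  define C where "C = (2/46) *\<^sub>R B - (7/920) *\<^sub>R (transpose B ** B)"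
  define \<tau> where "\<tau> = (7/920) *\<^sub>R (transpose B *v w) + (7/920) *\<^sub>R (transpose B *v w) - (2/46) *\<^sub>R w"
  have Cv: "C *v v = (2/46) *\<^sub>R (B *v v) - (7/920) *\<^sub>R (transpose B *v (B *v v))" for v
    by (simp add: C_def matrix_vector_mult_diff_rdistrib scaleR_matrix_vector_assoc matrix_vector_mul_assoc)
  \<comment> \<open>The operator bound is 2 * 2/46 + 4 * 7/920 = 27/230, which is below 1/8.\<close>
  have C: "norm (C *v v) \<le> norm v / 8" for v
  proof -
    have "norm (C *v v) \<le> 2/46 * norm (B *v v) + 7/920 * norm (transpose B *v (B *v v))"
      unfolding Cv by (rule order_trans[OF norm_triangle_ineq4]) simp
    then show ?thesis
      using B[of v] norm_transpose_vector_le[OF B, of "B *v v"] norm_ge_zero[of v] by argo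
  qed
  have trC: "trace C = 2/46 * trace B - 7/920 * (norm B)\<^sup>2"
    by (simp add: C_def trace_eq_inner_mat_1 inner_diff_right)
       (simp add: trace_matrix_mult power2_norm_eq_inner flip: trace_eq_inner_mat_1)
  \<comment> \<open>Here 27/460 = 2/46 + 2 * 7/920. Since 9/5 of its square is below 7/920, the
    negative |B|^2 term in \<open>trace C\<close> absorbs the second-order term.\<close>
  have "norm C \<le> 2/46 * norm B + 7/920 * norm (transpose B ** B)"
    unfolding C_def by (rule order_trans[OF norm_triangle_ineq4]) simp
  also have "\<dots> \<le> 27/460 * norm B"
    using norm_matrix_mult_le[OF norm_transpose_vector_le[OF B], of B] by simp
  finally have "(norm C)\<^sup>2 \<le> (27/460 * norm B)\<^sup>2"
    by (intro power_mono) simp_all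
  then have "(norm C)\<^sup>2 \<le> (27/460)\<^sup>2 * (norm B)\<^sup>2"
    by (simp only: power_mult_distrib)
  also have "\<dots> \<le> 5/9 * (7/920) * (norm B)\<^sup>2"
    by (intro mult_right_mono) (simp_all add: power2_eq_square)
  finally have "9/5 * (norm C)\<^sup>2 \<le> 7/920 * (norm B)\<^sup>2"
    by simp
  with trC have trace_bound: "trace C + 9/5 * (norm C)\<^sup>2 \<le> 2/46 * trace B" by simp
  have pointwise: "gaussian_dens \<sigma> z * exp (quad_stat \<sigma> B w z / (46 * \<sigma>\<^sup>2))
      \<le> exp (- (2/46 * trace B)) * gaussian_dens \<sigma> ((mat 1 - C) *v z + \<tau>)" for z
  proof -
    define p where "p = B *v z + w"
    have "(mat 1 - C) *v z + \<tau> = z - (2/46) *\<^sub>R p + (7/920) *\<^sub>R (transpose B *v (p + w))"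
      unfolding matrix_vector_mult_diff_rdistrib Cv \<tau>_def p_def matrix_vector_right_distrib scaleR_add_right
      by simp
    then have "(norm ((mat 1 - C) *v z + \<tau>))\<^sup>2 \<le> (norm z)\<^sup>2 - 4/46 * (z \<bullet> p) + 1/46 * (norm p)\<^sup>2"
      using completed_square_le[OF B, of z w] by (simp add: p_def)
    then have "(- (norm z)\<^sup>2 + 4/46 * (z \<bullet> p) - 1/46 * (norm p)\<^sup>2) / (2 * \<sigma>\<^sup>2)
        \<le> - (norm ((mat 1 - C) *v z + \<tau>))\<^sup>2 / (2 * \<sigma>\<^sup>2)"
      by (intro divide_right_mono) simp_all
    moreover have "- (norm z)\<^sup>2 / (2 * \<sigma>\<^sup>2) + quad_stat \<sigma> B w z / (46 * \<sigma>\<^sup>2)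
        = - (2/46 * trace B) + (- (norm z)\<^sup>2 + 4/46 * (z \<bullet> p) - 1/46 * (norm p)\<^sup>2) / (2 * \<sigma>\<^sup>2)"
      unfolding quad_stat_def p_def[symmetric] using \<sigma> by (simp add: field_simps)
    ultimately have "exp (- (norm z)\<^sup>2 / (2 * \<sigma>\<^sup>2) + quad_stat \<sigma> B w z / (46 * \<sigma>\<^sup>2))
        \<le> exp (- (2/46 * trace B) + - (norm ((mat 1 - C) *v z + \<tau>))\<^sup>2 / (2 * \<sigma>\<^sup>2))"
      by simp
    from mult_left_mono[OF this powr_ge_zero[of "2 * pi * \<sigma>\<^sup>2" "- real CARD('n) / 2"]] show ?thesis
      unfolding gaussian_dens_def exp_add by (simp only: mult_ac)
  qed
  have [measurable]: "(*v) X \<in> borel_measurable borel" for X :: "real^'n^'n"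
    by (intro borel_measurable_continuous_onI linear_continuous_on) simp
  have "(\<integral>\<^sup>+z. gaussian_dens \<sigma> z * exp (quad_stat \<sigma> B w z / (46 * \<sigma>\<^sup>2)) \<partial>lborel)
      \<le> (\<integral>\<^sup>+z. ennreal (exp (- (2/46 * trace B))) * gaussian_dens \<sigma> ((mat 1 - C) *v z + \<tau>) \<partial>lborel)"
    using pointwise by (intro nn_integral_mono) (simp add: ennreal_leI flip: ennreal_mult')
  also have "\<dots> = ennreal (exp (- (2/46 * trace B))) * (\<integral>\<^sup>+z. gaussian_dens \<sigma> ((mat 1 - C) *v z + \<tau>) \<partial>lborel)"
    by (rule nn_integral_cmult) measurable
  also have "\<dots> \<le> ennreal (exp (- (2/46 * trace B))) * exp (trace C + 9/5 * (norm C)\<^sup>2)"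
    by (intro mult_left_mono nn_integral_gaussian_dens_affine_le \<sigma> C) simp
  also have "\<dots> \<le> ennreal 1"
    unfolding ennreal_mult'[symmetric, OF exp_ge_zero] exp_add[symmetric] using trace_bound by (intro ennreal_leI) simp
  finally show ?thesis by simp
qed

section \<open>Tail bound for the quadratic statistic\<close>

lemma prob_space_gaussian_vec:
  assumes "\<sigma> > 0" shows "prob_space (gaussian_vec \<sigma> :: (real^'n::finite) measure)"
  by (rule prob_spaceI) (simp add: gaussian_vec_eq emeasure_density nn_integral_gaussian_dens[OF assms])

lemma sets_gaussian_vec [simp, measurable_cong]: "sets (gaussian_vec \<sigma>) = sets borel"
  by (simp add: gaussian_vec_eq)

lemma space_gaussian_vec [simp]: "space (gaussian_vec \<sigma>) = UNIV"
  by (simp add: gaussian_vec_eq)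

lemma continuous_quad_stat: "continuous_on UNIV (quad_stat \<sigma> B w)"
proof -
  have "continuous_on UNIV ((*v) B)" by (intro linear_continuous_on) simp
  then show ?thesis unfolding quad_stat_def by (intro continuous_intros) auto
qed

text \<open>Markov's inequality for the exponential of \<open>quad_stat\<close> divided by
  \<open>46 * \<sigma>\<^sup>2\<close>: on the event the indicator is at most exp (-t) times that
  exponential.\<close>

lemma measure_quad_stat_gt_le:
  fixes B :: "real^'n::finite^'n"
  assumes \<sigma>: "\<sigma> > 0" and B: "\<And>v. norm (B *v v) \<le> 2 * norm v"
  shows "measure (gaussian_vec \<sigma>) {z. quad_stat \<sigma> B w z > 46 * \<sigma>\<^sup>2 * t} \<le> exp (- t)"
proof -
  interpret prob_space "gaussian_vec \<sigma> :: (real^'n) measure" by (rule prob_space_gaussian_vec[OF \<sigma>])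
  have [measurable]: "quad_stat \<sigma> B w \<in> borel_measurable borel"
    by (intro borel_measurable_continuous_onI continuous_quad_stat)
  let ?S = "{z. quad_stat \<sigma> B w z > 46 * \<sigma>\<^sup>2 * t}"
  have "emeasure (gaussian_vec \<sigma>) ?S = (\<integral>\<^sup>+z. ennreal (gaussian_dens \<sigma> z) * indicator ?S z \<partial>lborel)"
    unfolding gaussian_vec_eq by (subst emeasure_density) auto
  also have "\<dots> \<le> (\<integral>\<^sup>+z. ennreal (exp (- t)) * (gaussian_dens \<sigma> z * exp (quad_stat \<sigma> B w z / (46 * \<sigma>\<^sup>2))) \<partial>lborel)"
  proof (intro nn_integral_mono)
    fix z :: "real^'n"
    show "ennreal (gaussian_dens \<sigma> z) * indicator ?S z
      \<le> ennreal (exp (- t)) * ennreal (gaussian_dens \<sigma> z * exp (quad_stat \<sigma> B w z / (46 * \<sigma>\<^sup>2)))"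
    proof (cases "z \<in> ?S")
      case True
      then have "1 \<le> exp (- t + quad_stat \<sigma> B w z / (46 * \<sigma>\<^sup>2))"
        using \<sigma> by (simp add: field_simps)
      then have "gaussian_dens \<sigma> z * 1 \<le> gaussian_dens \<sigma> z * exp (- t + quad_stat \<sigma> B w z / (46 * \<sigma>\<^sup>2))"
        by (intro mult_left_mono) simp_all
      then have "gaussian_dens \<sigma> z \<le> exp (- t) * (gaussian_dens \<sigma> z * exp (quad_stat \<sigma> B w z / (46 * \<sigma>\<^sup>2)))"
        unfolding exp_add by (simp only: mult_1_right mult_ac)
      then show ?thesis using True by (simp add: ennreal_leI flip: ennreal_mult')
    qed simp
  qed
  also have "\<dots> = ennreal (exp (- t)) * (\<integral>\<^sup>+z. gaussian_dens \<sigma> z * exp (quad_stat \<sigma> B w z / (46 * \<sigma>\<^sup>2)) \<partial>lborel)"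
    by (rule nn_integral_cmult) measurable
  also have "\<dots> \<le> ennreal (exp (- t)) * 1"
    by (intro mult_left_mono nn_integral_exp_quad_stat_le \<sigma> B) simp
  finally show ?thesis by (simp add: emeasure_eq_measure)
qed

section \<open>The criterion on the simplex and its minimisers\<close>

lemma sum_axis_scaleR: "(\<Sum>j\<in>UNIV. axis k (1::real) $ j *\<^sub>R g j) = (g k :: 'a::real_vector)"
  by (simp add: axis_def if_distrib[of "\<lambda>c. c *\<^sub>R _"] cong: if_cong)

lemma mu_th_eq_sum: "mu_th A b \<theta> y = (\<Sum>j\<in>UNIV. \<theta> $ j *\<^sub>R mu_j A b j y)"
proof -
  have "linear (\<lambda>X::real^'n^'n. X *v y)" for y
    by (intro linearI) (simp_all add: matrix_vector_mult_add_rdistrib scaleR_matrix_vector_assoc)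
  then have "A_th A \<theta> *v y = (\<Sum>j\<in>UNIV. (\<theta> $ j *\<^sub>R A j) *v y)"
    unfolding A_th_def by (rule linear_sum)
  then show ?thesis
    by (simp add: mu_th_def b_th_def mu_j_def scaleR_matrix_vector_assoc scaleR_add_right sum.distrib)
qed

lemma trace_A_th: "trace (A_th A \<theta>) = (\<Sum>j\<in>UNIV. \<theta> $ j * trace (A j))"
  by (simp add: trace_eq_inner_mat_1 A_th_def inner_sum_right)

text \<open>On the simplex the penalty is a variance, the weighted mean of |mu_j|^2 minus
  |mu_\<theta>|^2. Half of it leaves |mu_\<theta>|^2 / 2 as the only part of the criterion not
  linear in \<theta>.\<close>

lemma Hpen_eq:
  assumes "\<theta> \<in> simplexM"
  shows "Hpen A b \<sigma> y \<theta> = (norm (mu_th A b \<theta> y))\<^sup>2 / 2 +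
    (\<Sum>j\<in>UNIV. \<theta> $ j * ((norm (mu_j A b j y))\<^sup>2 / 2 - 2 * (y \<bullet> mu_j A b j y) + 2 * \<sigma>\<^sup>2 * trace (A j)))"
proof -
  define m where "m = mu_th A b \<theta> y"
  have sum1: "(\<Sum>j\<in>UNIV. \<theta> $ j) = 1" using assms by (simp add: simplexM_def)
  have inner: "v \<bullet> m = (\<Sum>j\<in>UNIV. \<theta> $ j * (v \<bullet> mu_j A b j y))" for v
    by (simp add: m_def mu_th_eq_sum inner_sum_right)
  have "pen A b y \<theta> = (\<Sum>j\<in>UNIV. \<theta> $ j * (norm m)\<^sup>2 - 2 * (\<theta> $ j * (m \<bullet> mu_j A b j y)) + \<theta> $ j * (norm (mu_j A b j y))\<^sup>2)"
    unfolding pen_def m_def[symmetric]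
    by (intro sum.cong refl) (simp add: power2_norm_eq_inner inner_diff_left inner_diff_right inner_commute algebra_simps)
  also have "\<dots> = (norm m)\<^sup>2 - 2 * (m \<bullet> m) + (\<Sum>j\<in>UNIV. \<theta> $ j * (norm (mu_j A b j y))\<^sup>2)"
    unfolding inner[of m] by (simp add: sum.distrib sum_subtractf sum1 flip: sum_distrib_left sum_distrib_right)
  finally have "pen A b y \<theta> = (\<Sum>j\<in>UNIV. \<theta> $ j * (norm (mu_j A b j y))\<^sup>2) - (norm m)\<^sup>2"
    by (simp add: power2_norm_eq_inner)
  moreover have "(\<Sum>j\<in>UNIV. \<theta> $ j * ((norm (mu_j A b j y))\<^sup>2 / 2 - 2 * (y \<bullet> mu_j A b j y) + 2 * \<sigma>\<^sup>2 * trace (A j)))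
     = (\<Sum>j\<in>UNIV. \<theta> $ j * (norm (mu_j A b j y))\<^sup>2) / 2 - 2 * (y \<bullet> m) + 2 * \<sigma>\<^sup>2 * trace (A_th A \<theta>)"
    unfolding inner trace_A_th sum_divide_distrib sum_distrib_left
    by (simp add: algebra_simps sum.distrib sum_subtractf)
  ultimately show ?thesis
    unfolding Hpen_def Cp_def m_def[symmetric] by (simp add: diff_divide_distrib)
qed

text \<open>At coordinates of zero prior weight the extended product is 0 times infinity, which is
  0, and the real product vanishes as well.\<close>

lemma Vpen_finite:
  assumes "\<And>j. \<pi> $ j = 0 \<Longrightarrow> \<theta> $ j = 0"
  shows "Vpen A b \<sigma> \<pi> y \<theta> = ereal (Hpen A b \<sigma> y \<theta> + 46 * \<sigma>\<^sup>2 * (\<Sum>j\<in>UNIV. \<theta> $ j * ln (1 / \<pi> $ j)))"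
proof -
  have "ereal (\<theta> $ j) * logInv (\<pi> $ j) = ereal (\<theta> $ j * ln (1 / \<pi> $ j))" for j
    using assms[of j] by (cases "\<pi> $ j = 0") (simp_all add: logInv_def flip: zero_ereal_def)
  then show ?thesis by (simp add: Vpen_def)
qed

lemma Vpen_infinite:
  assumes "\<sigma> > 0" "\<theta> \<in> simplexM" "\<pi> $ j = 0" "\<theta> $ j \<noteq> 0"
  shows "Vpen A b \<sigma> \<pi> y \<theta> = \<infinity>"
proof -
  have "\<theta> $ j > 0" using assms by (simp add: simplexM_def order_less_le)
  then have "ereal (\<theta> $ j) * logInv (\<pi> $ j) = \<infinity>" using assms by (simp add: logInv_def)
  then have "(\<Sum>j\<in>UNIV. ereal (\<theta> $ j) * logInv (\<pi> $ j)) = \<infinity>"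
    by (subst sum_Pinfty) auto
  then show ?thesis using assms by (simp add: Vpen_def)
qed

lemma axis_in_simplexM: "axis k 1 \<in> simplexM"
  by (simp add: simplexM_def axis_def)

lemma convex_simplexM:
  assumes "\<theta> \<in> simplexM" "\<eta> \<in> simplexM" "0 \<le> t" "t \<le> 1"
  shows "(1 - t) *\<^sub>R \<theta> + t *\<^sub>R \<eta> \<in> simplexM"
  using assms by (simp add: simplexM_def sum.distrib flip: sum_distrib_left)

text \<open>The prior weights sum to 1, so some vertex has nonzero weight and a finite criterion;
  mass outside the support of \<open>\<pi>\<close> would cost infinity.\<close>

lemma Vpen_minimizer_support:
  assumes "\<sigma> > 0" "\<pi> \<in> simplexM" "\<theta> \<in> simplexM"
    and min: "\<And>\<eta>. \<eta> \<in> simplexM \<Longrightarrow> Vpen A b \<sigma> \<pi> y \<theta> \<le> Vpen A b \<sigma> \<pi> y \<eta>"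
    and "\<pi> $ j = 0"
  shows "\<theta> $ j = 0"
proof (rule ccontr)
  assume "\<theta> $ j \<noteq> 0"
  then have inf: "Vpen A b \<sigma> \<pi> y \<theta> = \<infinity>" by (rule Vpen_infinite[OF assms(1,3,5)])
  obtain k where k: "\<pi> $ k \<noteq> 0"
    using \<open>\<pi> \<in> simplexM\<close> by (fastforce simp: simplexM_def)
  have "Vpen A b \<sigma> \<pi> y (axis k 1) \<noteq> \<infinity>"
    using k by (subst Vpen_finite) (auto simp: axis_def)
  then show False using min[OF axis_in_simplexM[of k]] inf by simp
qed

text \<open>Minimality is tested on the segment towards vertex \<open>k\<close>. There the criterion
  is quadratic in t; dividing by t and letting t tend to 0 leaves the half squared distance as a
  gain. \<open>d\<close> collects the linear coefficients.\<close>

lemma Vpen_minimizer_le_vertex: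
  assumes "\<sigma> > 0" "\<pi> \<in> simplexM" and \<theta>: "\<theta> \<in> simplexM"
    and min: "\<And>\<eta>. \<eta> \<in> simplexM \<Longrightarrow> Vpen A b \<sigma> \<pi> y \<theta> \<le> Vpen A b \<sigma> \<pi> y \<eta>"
    and k: "\<pi> $ k \<noteq> 0"
  defines "d \<equiv> \<lambda>j. (norm (mu_j A b j y))\<^sup>2 / 2 - 2 * (y \<bullet> mu_j A b j y) + 2 * \<sigma>\<^sup>2 * trace (A j) + 46 * \<sigma>\<^sup>2 * ln (1 / \<pi> $ j)"
  shows "(norm (mu_th A b \<theta> y))\<^sup>2 / 2 + (\<Sum>j\<in>UNIV. \<theta> $ j * d j) + (norm (mu_th A b \<theta> y - mu_j A b k y))\<^sup>2 / 2
    \<le> (norm (mu_j A b k y))\<^sup>2 / 2 + d k"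
proof -
  have supp: "\<theta> $ j = 0" if "\<pi> $ j = 0" for j
    by (rule Vpen_minimizer_support[OF assms(1-3) min that])
  define v where "v \<eta> = (norm (mu_th A b \<eta> y))\<^sup>2 / 2 + (\<Sum>j\<in>UNIV. \<eta> $ j * d j)" for \<eta>
  have V: "Vpen A b \<sigma> \<pi> y \<eta> = ereal (v \<eta>)" if "\<eta> \<in> simplexM" "\<And>j. \<pi> $ j = 0 \<Longrightarrow> \<eta> $ j = 0" for \<eta>
    by (subst Vpen_finite[OF that(2)], assumption)
       (simp add: Hpen_eq[OF that(1)] v_def d_def distrib_left sum.distrib sum_distrib_left mult.left_commute)
  define m where "m = mu_th A b \<theta> y"
  define u where "u = mu_j A b k y"
  have line: "t * v \<theta> \<le> t * ((norm u)\<^sup>2 / 2 + d k) - t * (1 - t) * ((norm (m - u))\<^sup>2 / 2)" if t: "0 < t" "t < 1" for t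
  proof -
    define \<eta> where "\<eta> = (1 - t) *\<^sub>R \<theta> + t *\<^sub>R axis k 1"
    have \<eta>: "\<eta> \<in> simplexM" unfolding \<eta>_def using t by (intro convex_simplexM \<theta> axis_in_simplexM) auto
    have mu: "mu_th A b \<eta> y = (1 - t) *\<^sub>R m + t *\<^sub>R u"
      unfolding m_def u_def mu_th_eq_sum \<eta>_def vector_add_component vector_scaleR_component real_scaleR_def
        scaleR_add_left sum.distrib scaleR_scaleR[symmetric] scaleR_sum_right[symmetric] sum_axis_scaleR ..
    have lin: "(\<Sum>j\<in>UNIV. \<eta> $ j * d j) = (1 - t) * (\<Sum>j\<in>UNIV. \<theta> $ j * d j) + t * d k"
      using sum_axis_scaleR[of k d] unfolding \<eta>_def
      by (simp add: distrib_right sum.distrib mult.assoc flip: sum_distrib_left)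
    have quad: "(norm ((1 - t) *\<^sub>R m + t *\<^sub>R u))\<^sup>2 = (1 - t) * (norm m)\<^sup>2 + t * (norm u)\<^sup>2 - t * (1 - t) * (norm (m - u))\<^sup>2"
      unfolding power2_norm_eq_inner
      by (simp add: inner_add_left inner_add_right inner_diff_left inner_diff_right inner_commute algebra_simps)
    \<comment> \<open>The segment stays in the support of \<open>\<pi>\<close> because
      \<open>k\<close> does, so the criterion is real along it.\<close>
    have "\<eta> $ j = 0" if "\<pi> $ j = 0" for j
      using supp[OF that] that k by (auto simp: \<eta>_def axis_def)
    then have "v \<theta> \<le> v \<eta>"
      using min[OF \<eta>] V[OF \<theta> supp] V[OF \<eta>] by simp
    also have "v \<eta> = (1 - t) * v \<theta> + (t * ((norm u)\<^sup>2 / 2 + d k) - t * (1 - t) * ((norm (m - u))\<^sup>2 / 2))"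
      unfolding v_def mu lin quad m_def[symmetric] by (simp add: field_simps)
    finally show ?thesis by (simp add: algebra_simps)
  qed
  \<comment> \<open>The passage to the limit, with s = 1 - t tending to 1.\<close>
  have "(norm (m - u))\<^sup>2 / 2 \<le> (norm u)\<^sup>2 / 2 + d k - v \<theta>"
  proof (rule field_le_mult_one_interval)
    fix s :: real assume s: "0 < s" "s < 1"
    have "(1 - s) * v \<theta> \<le> (1 - s) * ((norm u)\<^sup>2 / 2 + d k - s * ((norm (m - u))\<^sup>2 / 2))"
      using line[of "1 - s"] s by (simp add: algebra_simps)
    then show "s * ((norm (m - u))\<^sup>2 / 2) \<le> (norm u)\<^sup>2 / 2 + d k - v \<theta>"
      using s by (simp add: mult_le_cancel_left_pos)
  qed
  then show ?thesis by (simp add: v_def m_def u_def)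
qed

text \<open>The constant vector is the difference of the two estimators at the noiseless observation
  \<open>f\<close>.\<close>

lemma quad_stat_estimators:
  "quad_stat \<sigma> (A j - A k) ((A j - A k) *v f + (b j - b k)) \<xi> =
    2 * (\<xi> \<bullet> (mu_j A b j (f + \<xi>) - mu_j A b k (f + \<xi>))) - 2 * \<sigma>\<^sup>2 * (trace (A j) - trace (A k))
    - (norm (mu_j A b j (f + \<xi>) - mu_j A b k (f + \<xi>)))\<^sup>2 / 2"
proof -
  have "(A j - A k) *v \<xi> + ((A j - A k) *v f + (b j - b k)) = mu_j A b j (f + \<xi>) - mu_j A b k (f + \<xi>)"
    by (simp add: mu_j_def algebra_simps)
  then show ?thesis by (simp add: quad_stat_def trace_sub)
qed

text \<open>Deterministic: the noise is controlled through \<open>Q\<close> alone. The log weight of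
  \<open>j\<close> in \<open>Q\<close> cancels against the criterion, while that of \<open>k\<close>
  comes once from \<open>Q\<close> and once from the criterion, whence 92 = 2 * 46.\<close>

lemma penalized_oracle_inequality:
  fixes f \<xi> :: "real^'n::finite"
  defines "y \<equiv> f + \<xi>"
  assumes \<sigma>: "\<sigma> > 0" and \<pi>: "\<pi> \<in> simplexM" and \<theta>: "\<theta> \<in> simplexM"
    and min: "\<And>\<eta>. \<eta> \<in> simplexM \<Longrightarrow> Vpen A b \<sigma> \<pi> y \<theta> \<le> Vpen A b \<sigma> \<pi> y \<eta>"
    and k: "\<pi> $ k \<noteq> 0"
    and Q: "\<And>j. \<pi> $ j \<noteq> 0 \<Longrightarrow> quad_stat \<sigma> (A j - A k) ((A j - A k) *v f + (b j - b k)) \<xi>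
      \<le> 46 * \<sigma>\<^sup>2 * (ln (1 / \<pi> $ j) + ln (1 / \<pi> $ k) + x)"
  shows "(norm (mu_th A b \<theta> y - f))\<^sup>2
    \<le> (norm (mu_j A b k y - f))\<^sup>2 + 92 * \<sigma>\<^sup>2 * ln (1 / \<pi> $ k) + 46 * \<sigma>\<^sup>2 * x"
proof -
  define \<mu> where "\<mu> j = mu_j A b j y" for j
  define m where "m = mu_th A b \<theta> y"
  define l where "l j = ln (1 / \<pi> $ j)" for j
  define P where "P = 46 * \<sigma>\<^sup>2 * l k"
  define q where "q j = 2 * (\<xi> \<bullet> (\<mu> j - \<mu> k)) - 2 * \<sigma>\<^sup>2 * (trace (A j) - trace (A k)) - (norm (\<mu> j - \<mu> k))\<^sup>2 / 2" for j
  have sum1: "(\<Sum>j\<in>UNIV. \<theta> $ j) = 1" and pos: "\<And>j. 0 \<le> \<theta> $ j" using \<theta> by (auto simp: simplexM_def)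
  have inner: "v \<bullet> m = (\<Sum>j\<in>UNIV. \<theta> $ j * (v \<bullet> \<mu> j))" for v
    by (simp add: m_def \<mu>_def mu_th_eq_sum inner_sum_right)
  have "\<theta> $ j * (q j - 46 * \<sigma>\<^sup>2 * l j) \<le> \<theta> $ j * (46 * \<sigma>\<^sup>2 * (l k + x))" for j
  proof (cases "\<pi> $ j = 0")
    case True
    then show ?thesis using Vpen_minimizer_support[OF \<sigma> \<pi> \<theta> min] by simp
  next
    case False
    then have "q j \<le> 46 * \<sigma>\<^sup>2 * (l j + l k + x)"
      using Q[of j] unfolding quad_stat_estimators q_def \<mu>_def l_def y_def by simp
    then show ?thesis by (intro mult_left_mono pos) (simp add: algebra_simps)
  qed
  then have "(\<Sum>j\<in>UNIV. \<theta> $ j * (q j - 46 * \<sigma>\<^sup>2 * l j)) \<le> (\<Sum>j\<in>UNIV. \<theta> $ j * (46 * \<sigma>\<^sup>2 * (l k + x)))"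
    by (intro sum_mono)
  also have "\<dots> = P + 46 * \<sigma>\<^sup>2 * x"
    unfolding sum_distrib_right[symmetric] sum1 by (simp add: P_def distrib_left)
  finally have upper: "(\<Sum>j\<in>UNIV. \<theta> $ j * (q j - 46 * \<sigma>\<^sup>2 * l j)) \<le> P + 46 * \<sigma>\<^sup>2 * x" .
  define d where "d j = (norm (\<mu> j))\<^sup>2 / 2 - 2 * (y \<bullet> \<mu> j) + 2 * \<sigma>\<^sup>2 * trace (A j) + 46 * \<sigma>\<^sup>2 * l j" for j
  \<comment> \<open>The square of \<open>\<mu> j\<close> is contained in \<open>d j\<close> and the
    other terms are linear in \<open>\<mu> j\<close>, so averaging over \<theta> produces
    \<open>m\<close>.\<close>
  have q_eq: "q j - 46 * \<sigma>\<^sup>2 * l j = - d j - 2 * (f \<bullet> \<mu> j) + \<mu> k \<bullet> \<mu> j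
      + (2 * \<sigma>\<^sup>2 * trace (A k) - 2 * (\<xi> \<bullet> \<mu> k) - (norm (\<mu> k))\<^sup>2 / 2)" for j
    by (simp add: q_def d_def y_def power2_norm_eq_inner inner_diff_left inner_diff_right inner_add_left
        inner_add_right inner_commute field_simps)
  have "\<theta> $ j * (q j - 46 * \<sigma>\<^sup>2 * l j) = - (\<theta> $ j * d j) - 2 * (\<theta> $ j * (f \<bullet> \<mu> j)) + \<theta> $ j * (\<mu> k \<bullet> \<mu> j)
      + \<theta> $ j * (2 * \<sigma>\<^sup>2 * trace (A k) - 2 * (\<xi> \<bullet> \<mu> k) - (norm (\<mu> k))\<^sup>2 / 2)" for j
    unfolding q_eq by (simp add: algebra_simps)
  then have "(\<Sum>j\<in>UNIV. \<theta> $ j * (q j - 46 * \<sigma>\<^sup>2 * l j)) = - (\<Sum>j\<in>UNIV. \<theta> $ j * d j) - 2 * (f \<bullet> m) + \<mu> k \<bullet> m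
      + (2 * \<sigma>\<^sup>2 * trace (A k) - 2 * (\<xi> \<bullet> \<mu> k) - (norm (\<mu> k))\<^sup>2 / 2)"
    unfolding inner by (simp add: sum.distrib sum_subtractf sum_negf sum1 flip: sum_distrib_left sum_distrib_right)
  \<comment> \<open>The gained half squared distance raises |m|^2 / 2 to the full |m|^2 of the loss
    and supplies the term \<open>\<mu> k \<bullet> m\<close>.\<close>
  moreover have "(norm m)\<^sup>2 / 2 + (\<Sum>j\<in>UNIV. \<theta> $ j * d j) + (norm (m - \<mu> k))\<^sup>2 / 2 \<le> (norm (\<mu> k))\<^sup>2 / 2 + d k"
    unfolding m_def \<mu>_def d_def l_def by (rule Vpen_minimizer_le_vertex[OF \<sigma> \<pi> \<theta> min k])
  moreover have "(norm (m - f))\<^sup>2 = (norm m)\<^sup>2 - 2 * (f \<bullet> m) + (norm f)\<^sup>2"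
    "(norm (\<mu> k - f))\<^sup>2 = (norm (\<mu> k))\<^sup>2 - 2 * (f \<bullet> \<mu> k) + (norm f)\<^sup>2"
    "(norm (m - \<mu> k))\<^sup>2 = (norm m)\<^sup>2 - 2 * (\<mu> k \<bullet> m) + (norm (\<mu> k))\<^sup>2"
    by (simp_all add: power2_norm_eq_inner inner_diff_left inner_diff_right inner_commute)
  moreover have "d k = (norm (\<mu> k))\<^sup>2 / 2 - 2 * (f \<bullet> \<mu> k) - 2 * (\<xi> \<bullet> \<mu> k) + 2 * \<sigma>\<^sup>2 * trace (A k) + P"
    by (simp add: P_def d_def y_def inner_add_left)
  ultimately have "(norm (m - f))\<^sup>2 \<le> (norm (\<mu> k - f))\<^sup>2 + 2 * P + 46 * \<sigma>\<^sup>2 * x"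
    using upper by argo
  then show ?thesis by (simp add: m_def \<mu>_def l_def P_def)
qed

section \<open>Union bound over pairs of estimators\<close>

lemma norm_diff_matrix_vector_le:
  fixes X Y :: "real^'n::finite^'n"
  assumes "onorm (\<lambda>v. X *v v) \<le> 1" "onorm (\<lambda>v. Y *v v) \<le> 1"
  shows "norm ((X - Y) *v v) \<le> 2 * norm v"
proof -
  have contr: "norm (Z *v v) \<le> norm v" if "onorm (\<lambda>v. Z *v v) \<le> 1" for Z :: "real^'n^'n"
  proof -
    have "norm (Z *v v) \<le> onorm (\<lambda>v. Z *v v) * norm v"
      by (rule onorm) simp
    also have "\<dots> \<le> 1 * norm v" using that by (intro mult_right_mono) simp_all
    finally show ?thesis by simp
  qed
  show ?thesis
    using norm_triangle_ineq4[of "X *v v" "Y *v v"] contr[OF assms(1)] contr[OF assms(2)]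
    by (simp add: matrix_vector_mult_diff_rdistrib)
qed

text \<open>The probability is expressed through a measurable event \<open>E\<close> on which the
  bound holds, as \<open>thetahat\<close> is an arbitrary selection of minimisers.\<close>

theorem theorem5p1:
  fixes A :: "'m::finite \<Rightarrow> real^'n::finite^'n"
    and b :: "'m \<Rightarrow> real^'n"
    and f :: "real^'n"
    and \<sigma> :: real
    and \<pi> :: "real^'m"
    and thetahat :: "real^'n \<Rightarrow> real^'m"
    and x :: real
  assumes "CARD('m) \<ge> 2"
    and "\<sigma> > 0"
    and "\<forall>j. onorm (\<lambda>v. A j *v v) \<le> 1"
    and "\<pi> \<in> simplexM"
    and "\<forall>y. thetahat y \<in> simplexM \<and>
           (\<forall>\<theta>\<in>simplexM. Vpen A b \<sigma> \<pi> y (thetahat y) \<le> Vpen A b \<sigma> \<pi> y \<theta>)"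
    and "x > 0"
  shows "\<exists>E\<in>sets (gaussian_vec \<sigma>).
           measure (gaussian_vec \<sigma>) E \<ge> 1 - 2 * exp (- x) \<and>
           (\<forall>\<xi>\<in>E. ereal ((norm (mu_th A b (thetahat (f + \<xi>)) (f + \<xi>) - f))^2)
              \<le> (MIN j. ereal ((norm (mu_j A b j (f + \<xi>) - f))^2) + ereal (92 * \<sigma>^2) * logInv (\<pi>$j))
                 + ereal (46 * \<sigma>^2 * x))"
proof -
  interpret prob_space "gaussian_vec \<sigma> :: (real^'n) measure" by (rule prob_space_gaussian_vec[OF assms(2)])
  define S where "S = {j. \<pi> $ j \<noteq> 0}"
  define Q where "Q = (\<lambda>(j, k). quad_stat \<sigma> (A j - A k) ((A j - A k) *v f + (b j - b k)))"
  \<comment> \<open>The log weights in the threshold give each pair the failure probability exp (-x)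
    \<pi>_j \<pi>_k, and these sum to exp (-x).\<close>
  define bad where "bad = (\<lambda>(j, k). {\<xi>. Q (j, k) \<xi> > 46 * \<sigma>\<^sup>2 * (ln (1 / \<pi> $ j) + ln (1 / \<pi> $ k) + x)})"
  have \<pi>_pos: "\<pi> $ j > 0" if "j \<in> S" for j
    using assms(4) that by (simp add: S_def simplexM_def order_less_le)
  have [measurable]: "Q i \<in> borel_measurable borel" for i
    by (cases i) (auto simp: Q_def intro!: borel_measurable_continuous_onI continuous_quad_stat)
  have bad_sets: "bad i \<in> events" for i
    by (cases i) (simp add: bad_def)
  have bad_le: "prob (bad (j, k)) \<le> exp (- x) * (\<pi> $ j * \<pi> $ k)" if "j \<in> S" "k \<in> S" for j k
  proof -
    have "prob (bad (j, k)) \<le> exp (- (ln (1 / \<pi> $ j) + ln (1 / \<pi> $ k) + x))"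
      unfolding bad_def Q_def prod.case using assms(3)
      by (intro measure_quad_stat_gt_le assms(2) norm_diff_matrix_vector_le) auto
    also have "- (ln (1 / \<pi> $ j) + ln (1 / \<pi> $ k) + x) = - x + (ln (\<pi> $ j) + ln (\<pi> $ k))"
      using \<pi>_pos that by (simp add: ln_div)
    also have "exp \<dots> = exp (- x) * (\<pi> $ j * \<pi> $ k)"
      using \<pi>_pos that by (simp only: exp_add exp_ln)
    finally show ?thesis .
  qed
  define E where "E = UNIV - (\<Union>i\<in>S \<times> S. bad i)"
  have "prob (\<Union>i\<in>S \<times> S. bad i) \<le> (\<Sum>i\<in>S \<times> S. prob (bad i))"
    using bad_sets by (intro finite_measure_subadditive_finite) auto
  also have "\<dots> \<le> (\<Sum>(j, k)\<in>S \<times> S. exp (- x) * (\<pi> $ j * \<pi> $ k))"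
    using bad_le by (intro sum_mono) auto
  also have "\<dots> = exp (- x) * ((\<Sum>j\<in>S. \<pi> $ j) * (\<Sum>k\<in>S. \<pi> $ k))"
    unfolding sum_product sum.cartesian_product by (simp add: sum_distrib_left split_def)
  also have "(\<Sum>j\<in>S. \<pi> $ j) = (\<Sum>j\<in>UNIV. \<pi> $ j)"
    by (intro sum.mono_neutral_left) (auto simp: S_def)
  also have "\<dots> = 1" using assms(4) by (simp add: simplexM_def)
  finally have "prob (\<Union>i\<in>S \<times> S. bad i) \<le> exp (- x)" by simp
  moreover have "prob E = 1 - prob (\<Union>i\<in>S \<times> S. bad i)"
    unfolding E_def using prob_compl[of "\<Union>i\<in>S \<times> S. bad i"] bad_sets by simp
  ultimately have prob_E: "1 - 2 * exp (- x) \<le> prob E"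
    using exp_gt_zero[of "- x"] by linarith
  show ?thesis
  proof (intro bexI conjI ballI)
    show "E \<in> events" unfolding E_def using bad_sets by auto
    show "1 - 2 * exp (- x) \<le> prob E" by (rule prob_E)
    fix \<xi> assume \<xi>: "\<xi> \<in> E"
    let ?F = "\<lambda>j. ereal ((norm (mu_j A b j (f + \<xi>) - f))\<^sup>2) + ereal (92 * \<sigma>\<^sup>2) * logInv (\<pi> $ j)"
    have "Min (range ?F) \<in> range ?F" by (intro Min_in) auto
    then obtain k where k: "Min (range ?F) = ?F k" by (rule imageE)
    \<comment> \<open>At the index \<open>k\<close> attaining the minimum, a zero prior weight makes
      the right side infinite; otherwise \<open>E\<close> excludes every bad pair with second index
      \<open>k\<close>.\<close>
    have "ereal ((norm (mu_th A b (thetahat (f + \<xi>)) (f + \<xi>) - f))\<^sup>2) \<le> ?F k + ereal (46 * \<sigma>\<^sup>2 * x)"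
    proof (cases "k \<in> S")
      case True
      have "quad_stat \<sigma> (A j - A k) ((A j - A k) *v f + (b j - b k)) \<xi>
          \<le> 46 * \<sigma>\<^sup>2 * (ln (1 / \<pi> $ j) + ln (1 / \<pi> $ k) + x)" if "\<pi> $ j \<noteq> 0" for j
        using \<xi> True that by (auto simp: E_def bad_def Q_def S_def not_less)
      then have "(norm (mu_th A b (thetahat (f + \<xi>)) (f + \<xi>) - f))\<^sup>2
          \<le> (norm (mu_j A b k (f + \<xi>) - f))\<^sup>2 + 92 * \<sigma>\<^sup>2 * ln (1 / \<pi> $ k) + 46 * \<sigma>\<^sup>2 * x"
        using True assms(5) by (intro penalized_oracle_inequality assms) (auto simp: S_def)
      then show ?thesis using True by (simp add: S_def logInv_def)
    next
      case False
      then show ?thesis using assms(2) by (simp add: S_def logInv_def)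
    qed
    then show "ereal ((norm (mu_th A b (thetahat (f + \<xi>)) (f + \<xi>) - f))\<^sup>2) \<le> Min (range ?F) + ereal (46 * \<sigma>\<^sup>2 * x)"
      by (simp only: k)
  qed
qed

end
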